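(* The star digraphs $\vec{ST}_n$, $n\ge 1$, are strongly connected, and the chain $\mathcal D=\{D_1\subset D_2\subset\cdots\}$ with $D_n=\vec{ST}_{n+1}$ ($n\ge1$), where $D_n$ is embedded in $D_{n+1}$ by $\kappa_n(x_0x_1\dots x_n)=x_0x_1\dots x_n\,(n+1)$, is a dense segmental neighborly $E_\pm$-chain.
   Context: For $m\ge 1$, an even permutation $\sigma$ of $\{0,\dots,m-1\}$ is written as the tuple $x_0\dots x_{m-1}$ with $x_k=\sigma(k)$. The star digraph $\vec{ST}_m$ has vertex set $\mathrm{Alt}_m$ and, for each $i\in\{2,\dots,m-1\}$, an arc from $x_0x_1\dots x_{m-1}$ to $y_0y_1\dots y_{m-1}$ where $y_0=x_i$, $y_1=x_0$, $y_i=x_1$, $y_k=x_k$ otherwise (Cayley digraph of $\mathrm{Alt}_m$ w.r.t. the $3$-cycles $(0\,1\,i)$); each vertex of $\vec{ST}_{n+1}$ has indegree and outdegree $n-1$. Let $D$ be a digraph. For $S\subseteq V(D)$, $N^-(S)$ (resp. $N^+(S)$) is the set of vertices $u\notin S$ with $(u,v)$ (resp. $(v,u)$) an arc for some $v\in S$. $S$ is $\pm$stable if every vertex of $D[S]$ has indegree $0$ or outdegree $0$ in $D[S]$; $S$ is $\pm$dominating if each $v\notin S$ has an in-neighbor $u\in S$ and an out-neighbor $w\in S$, perfect if these $u,w$ are unique; a worst-case efficient dominating set is a perfect $\pm$dominating $\pm$stable set. $S$ is cuneiform if $N^+(S)$ and $N^-(S)$ are disjoint stable (independent in the underlying undirected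 graph) sets and there is a bijection $\rho:S\to K$, $K$ a set of $|S|$ pairwise vertex-disjoint arcs each from a vertex of $N^+(S)$ to a vertex of $N^-(S)$, such that each $v\in S$ together with $\rho(v)$ induces a directed triangle. An $E_\pm$-set is a worst-case efficient dominating set that is cuneiform. An injective vertex map $\zeta:D\to D'$ between oriented simple graphs is an inclusive $(+)$map if it maps arcs to arcs with the same orientation and $\zeta(D)$ is an induced subdigraph of $D'$, and an inclusive $(-)$map if it maps each arc $(u,v)$ to the arc $(\zeta(v),\zeta(u))$ and $\zeta(D)$ is induced; both are called inclusive maps. A chain $D_1\subset D_2\subset\cdots$ of oriented simple graphs, with $D_n$ an induced subdigraph of $D_{n+1}$ via inclusive maps $\kappa_n:D_n\to D_{n+1}$, is an $E_\pm$-chain if each $D_n$ contains an $E_\pm$-set $S_n$. It is neighborly if $V(\kappa_n(D_n))$ is cuneiform in $D_{n+1}$ for every $n\ge1$. It is inclusive if (for such a choice of $E_\pm$-sets $S_n$) there are inclusive maps $\zeta_n:D_n\to D_{n+1}$ with $\zeta_n(S_n)\subseteq S_{n+1}$ for each $n$; it is segmental if moreover, for each $n$, $S_{n+1}$ is partitioned into images $\zeta_n^{(k)}(S_n)$ of $S_n$ under inclusive maps $\zeta_n^{(k)}:D_n\to D_{n+1}$, $k$ in a finite index set. If all $D_n$ have every vertex with equal indegree and outdegree, the $E_\pm$-chain is dense if $|S_n|/|V(D_n)|=2/(n+1)$ for each $n\ge1$.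
   Formalization: An E±-set is taken to be a worst-case efficient dominating set, without requiring it to be cuneiform: ±domination gives N⁺(S)=N⁻(S)=V∖S, so no nonempty digraph has a cuneiform one. Cuneiform is kept as stated in "neighborly". *)

theory Defs
  imports
    "Graph_Theory.Digraph_Component"
    "HOL-Combinatorics.Permutations"
    "HOL-Library.Disjoint_Sets"
    Complex_Main
begin

section \<open>Star digraphs\<close>

text \<open>
  A tuple \<open>x\<^sub>0 \<dots> x\<^sub>m\<^sub>-\<^sub>1\<close> is the function \<open>k \<mapsto> x\<^sub>k\<close>; as usual for \<^const>\<open>permutes\<close>, it is the
  identity outside \<open>{..<m}\<close>. So a permutation of \<open>{..<m}\<close> is literally also one of
  \<open>{..<m + 1}\<close>, and \<open>star_embed\<close> below, which appends the symbol \<open>n + 1\<close>, acts as the inclusion.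
\<close>

definition star_digraph :: "nat \<Rightarrow> (nat \<Rightarrow> nat) pair_pre_digraph" where
  "star_digraph m = \<lparr>
     pverts = {x. x permutes {..<m} \<and> evenperm x},
     parcs = {(x, y). x permutes {..<m} \<and> evenperm x \<and>
                (\<exists>i\<in>{2..<m}. y = x(0 := x i, 1 := x 0, i := x 1))} \<rparr>"

definition star_chain :: "nat \<Rightarrow> (nat \<Rightarrow> nat) pair_pre_digraph" where
  "star_chain n = star_digraph (n + 1)"

definition star_embed :: "nat \<Rightarrow> (nat \<Rightarrow> nat) \<Rightarrow> (nat \<Rightarrow> nat)" where
  "star_embed n x = x(n + 1 := n + 1)"

section \<open>Domination in digraphs\<close>

definition oriented_simple_graph :: "'a pair_pre_digraph \<Rightarrow> bool" where
  "oriented_simple_graph D \<longleftrightarrow>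
     pair_digraph D \<and> (\<forall>u v. (u, v) \<in> parcs D \<longrightarrow> (v, u) \<notin> parcs D)"

definition in_nbhd :: "'a pair_pre_digraph \<Rightarrow> 'a set \<Rightarrow> 'a set" where
  "in_nbhd D S = {u. u \<notin> S \<and> (\<exists>v\<in>S. (u, v) \<in> parcs D)}"

definition out_nbhd :: "'a pair_pre_digraph \<Rightarrow> 'a set \<Rightarrow> 'a set" where
  "out_nbhd D S = {u. u \<notin> S \<and> (\<exists>v\<in>S. (v, u) \<in> parcs D)}"

definition stable :: "'a pair_pre_digraph \<Rightarrow> 'a set \<Rightarrow> bool" where
  "stable D A \<longleftrightarrow> (\<forall>u\<in>A. \<forall>v\<in>A. (u, v) \<notin> parcs D)"

definition pm_stable :: "'a pair_pre_digraph \<Rightarrow> 'a set \<Rightarrow> bool" where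
  "pm_stable D S \<longleftrightarrow>
     (\<forall>v\<in>S. in_degree (with_proj D \<restriction> S) v = 0 \<or> out_degree (with_proj D \<restriction> S) v = 0)"

definition perfect_pm_dominating :: "'a pair_pre_digraph \<Rightarrow> 'a set \<Rightarrow> bool" where
  "perfect_pm_dominating D S \<longleftrightarrow>
     (\<forall>v \<in> pverts D - S. (\<exists>!u. u \<in> S \<and> (u, v) \<in> parcs D) \<and> (\<exists>!w. w \<in> S \<and> (v, w) \<in> parcs D))"

definition worst_case_efficient_dominating :: "'a pair_pre_digraph \<Rightarrow> 'a set \<Rightarrow> bool" where
  "worst_case_efficient_dominating D S \<longleftrightarrow>
     S \<subseteq> pverts D \<and> perfect_pm_dominating D S \<and> pm_stable D S"

definition induces_directed_triangle :: "'a pair_pre_digraph \<Rightarrow> 'a set \<Rightarrow> bool" where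
  "induces_directed_triangle D X \<longleftrightarrow>
     (\<exists>a b c. distinct [a, b, c] \<and> X = {a, b, c} \<and>
        arcs (with_proj D \<restriction> X) = {(a, b), (b, c), (c, a)})"

definition cuneiform :: "'a pair_pre_digraph \<Rightarrow> 'a set \<Rightarrow> bool" where
  "cuneiform D S \<longleftrightarrow>
     out_nbhd D S \<inter> in_nbhd D S = {} \<and> stable D (out_nbhd D S) \<and> stable D (in_nbhd D S) \<and>
     (\<exists>K \<rho>. K \<subseteq> parcs D \<inter> out_nbhd D S \<times> in_nbhd D S \<and>
        (\<forall>e\<in>K. \<forall>f\<in>K. e \<noteq> f \<longrightarrow> {fst e, snd e} \<inter> {fst f, snd f} = {}) \<and>
        bij_betw \<rho> S K \<and>
        (\<forall>v\<in>S. induces_directed_triangle D {v, fst (\<rho> v), snd (\<rho> v)}))"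

text \<open>
  Asking a worst-case efficient dominating set to be cuneiform as well is contradictory:
  domination in both directions makes both of its neighbourhoods equal to its complement,
  so they are disjoint only if \<open>S\<close> is everything, which leaves no arc for \<open>\<rho>\<close> to take as a value.
\<close>

lemma cuneiform_dominating_contradictory:
  assumes wf: "pair_wf_digraph D"
    and dom: "worst_case_efficient_dominating D S" and cun: "cuneiform D S"
  shows "pverts D = {}"
proof -
  have "pverts D - S \<subseteq> out_nbhd D S \<inter> in_nbhd D S"
    using dom
    unfolding worst_case_efficient_dominating_def perfect_pm_dominating_def
      out_nbhd_def in_nbhd_def
    by blast
  with cun have sub: "pverts D \<subseteq> S"
    unfolding cuneiform_def by blast
  have "in_nbhd D S = {}"
    using sub pair_wf_digraph.in_arcsD1[OF wf] unfolding in_nbhd_def by blast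
  then obtain \<rho> :: "'a \<Rightarrow> 'a \<times> 'a" where "bij_betw \<rho> S {}"
    using cun unfolding cuneiform_def by auto
  then have "S = {}"
    by (simp add: bij_betw_def)
  with sub show ?thesis by simp
qed

text \<open>
  Hence the cuneiform condition is not part of the following definition; it is kept, unchanged,
  for the copies of \<open>D n\<close> in \<open>D (n + 1)\<close>, see \<open>neighborly\<close>.
\<close>

definition Epm_set :: "'a pair_pre_digraph \<Rightarrow> 'a set \<Rightarrow> bool" where
  "Epm_set D S \<longleftrightarrow> worst_case_efficient_dominating D S"

section \<open>Inclusive maps and chains\<close>

definition plus_image :: "('a \<Rightarrow> 'b) \<Rightarrow> 'a pair_pre_digraph \<Rightarrow> 'b pair_pre_digraph" where
  "plus_image \<zeta> D =
     \<lparr> pverts = \<zeta> ` pverts D, parcs = {(\<zeta> u, \<zeta> v) | u v. (u, v) \<in> parcs D} \<rparr>"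

definition minus_image :: "('a \<Rightarrow> 'b) \<Rightarrow> 'a pair_pre_digraph \<Rightarrow> 'b pair_pre_digraph" where
  "minus_image \<zeta> D =
     \<lparr> pverts = \<zeta> ` pverts D, parcs = {(\<zeta> v, \<zeta> u) | u v. (u, v) \<in> parcs D} \<rparr>"

definition inclusive_plus_map ::
    "'a pair_pre_digraph \<Rightarrow> 'b pair_pre_digraph \<Rightarrow> ('a \<Rightarrow> 'b) \<Rightarrow> bool" where
  "inclusive_plus_map D D' \<zeta> \<longleftrightarrow>
     inj_on \<zeta> (pverts D) \<and> induced_subgraph (with_proj (plus_image \<zeta> D)) (with_proj D')"

definition inclusive_minus_map ::
    "'a pair_pre_digraph \<Rightarrow> 'b pair_pre_digraph \<Rightarrow> ('a \<Rightarrow> 'b) \<Rightarrow> bool" where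
  "inclusive_minus_map D D' \<zeta> \<longleftrightarrow>
     inj_on \<zeta> (pverts D) \<and> induced_subgraph (with_proj (minus_image \<zeta> D)) (with_proj D')"

definition inclusive_map ::
    "'a pair_pre_digraph \<Rightarrow> 'b pair_pre_digraph \<Rightarrow> ('a \<Rightarrow> 'b) \<Rightarrow> bool" where
  "inclusive_map D D' \<zeta> \<longleftrightarrow> inclusive_plus_map D D' \<zeta> \<or> inclusive_minus_map D D' \<zeta>"

text \<open>
  Chains are indexed by \<open>n \<ge> 1\<close>. The chosen \<open>E\<^sub>\<plusminus>\<close>-sets \<open>S n\<close> are a parameter, so that the
  conditions below can be required of one and the same choice.
\<close>

definition Epm_chain ::
    "(nat \<Rightarrow> 'a pair_pre_digraph) \<Rightarrow> (nat \<Rightarrow> 'a \<Rightarrow> 'a) \<Rightarrow> (nat \<Rightarrow> 'a set) \<Rightarrow> bool" where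
  "Epm_chain D \<kappa> S \<longleftrightarrow>
     (\<forall>n\<ge>1. oriented_simple_graph (D n) \<and>
            inclusive_map (D n) (D (n + 1)) (\<kappa> n) \<and>
            Epm_set (D n) (S n))"

definition neighborly ::
    "(nat \<Rightarrow> 'a pair_pre_digraph) \<Rightarrow> (nat \<Rightarrow> 'a \<Rightarrow> 'a) \<Rightarrow> bool" where
  "neighborly D \<kappa> \<longleftrightarrow> (\<forall>n\<ge>1. cuneiform (D (n + 1)) (\<kappa> n ` pverts (D n)))"

definition inclusive_chain ::
    "(nat \<Rightarrow> 'a pair_pre_digraph) \<Rightarrow> (nat \<Rightarrow> 'a set) \<Rightarrow> bool" where
  "inclusive_chain D S \<longleftrightarrow>
     (\<forall>n\<ge>1. \<exists>\<zeta>. inclusive_map (D n) (D (n + 1)) \<zeta> \<and> \<zeta> ` S n \<subseteq> S (n + 1))"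

definition segmental ::
    "(nat \<Rightarrow> 'a pair_pre_digraph) \<Rightarrow> (nat \<Rightarrow> 'a set) \<Rightarrow> bool" where
  "segmental D S \<longleftrightarrow> inclusive_chain D S \<and>
     (\<forall>n\<ge>1. \<exists>(I :: nat set) \<zeta>. finite I \<and>
        (\<forall>k\<in>I. inclusive_map (D n) (D (n + 1)) (\<zeta> k)) \<and>
        disjoint_family_on (\<lambda>k. \<zeta> k ` S n) I \<and>
        (\<Union>k\<in>I. \<zeta> k ` S n) = S (n + 1))"

definition dense ::
    "(nat \<Rightarrow> 'a pair_pre_digraph) \<Rightarrow> (nat \<Rightarrow> 'a set) \<Rightarrow> bool" where
  "dense D S \<longleftrightarrow>
     (\<forall>n\<ge>1. (\<forall>v \<in> pverts (D n). in_degree (with_proj (D n)) v = out_degree (with_proj (D n)) v) \<and>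
            real (card (S n)) / real (card (pverts (D n))) = 2 / (real n + 1))"

end

theory Submission
  imports Defs
begin

text \<open>
  Arcs are right multiplications by the 3-cycles \<open>c\<^sub>i = (0 i 1)\<close>, so left multiplications
  preserve arcs, and conjugation by the transposition \<open>s = (0 1)\<close> inverts every \<open>c\<^sub>i\<close>, hence
  reverses arcs. The \<open>E\<^sub>\<plusminus>\<close>-set consists of the tuples having the symbol 0 at position 0 or 1:
  if 0 is at position \<open>j \<ge> 2\<close>, then exactly the arcs belonging to \<open>c\<^sub>j\<close> join the tuple to this set.
  Fixing the last symbol \<open>k \<noteq> 0\<close> cuts this set into the images of the previous one
  under \<open>x \<mapsto> (k n+1) x s\<close> (under the inclusion, if \<open>k = n + 1\<close>). The orbits of \<open>c\<^sub>n\<^sub>+\<^sub>1\<close> provide the triangles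
  of neighborliness, and connectivity follows by induction, moving the largest symbol to the end.
\<close>

section \<open>Generators of the alternating group, and the arcs they define\<close>

text \<open>Writing the 3-cycle as a product of two transpositions lets evenness and
  \<open>permutes\<close> come from the rules for compositions.\<close>

definition star_cycle :: "nat \<Rightarrow> nat \<Rightarrow> nat" where
  "star_cycle i = transpose 0 1 \<circ> transpose 0 i"

lemma star_cycle_apply:
  assumes "i \<ge> 2"
  shows "star_cycle i 0 = i" "star_cycle i (Suc 0) = 0" "star_cycle i i = Suc 0"
    and "k \<noteq> 0 \<Longrightarrow> k \<noteq> Suc 0 \<Longrightarrow> k \<noteq> i \<Longrightarrow> star_cycle i k = k"
  using assms by (auto simp: star_cycle_def transpose_def)

lemma star_cycle_cube:
  assumes "i \<ge> 2"
  shows "star_cycle i \<circ> star_cycle i \<circ> star_cycle i = id"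
  using assms by (auto simp: star_cycle_def transpose_def fun_eq_iff)

text \<open>With s = (0 1) and t = (0 i), the cycle is s t, so c s c = s t s s t = s. This is the
  relation s c s = c^-1 in an inverse-free form; it is what makes \<open>star_twist\<close> reverse
  arcs.\<close>

lemma star_cycle_swap:
  "star_cycle i \<circ> transpose 0 1 \<circ> star_cycle i = transpose 0 1"
  by (simp add: star_cycle_def fun_eq_iff)

lemma star_step_eq_comp:
  assumes "i \<ge> 2"
  shows "x(0 := x i, 1 := x 0, i := x 1) = x \<circ> star_cycle i"
  using assms by (auto simp: star_cycle_def transpose_def fun_eq_iff)

lemma star_cycle_permutes:
  assumes "2 \<le> i" "i < m"
  shows "star_cycle i permutes {..<m}"
  unfolding star_cycle_def
  by (rule permutes_compose) (use assms in \<open>auto intro!: permutes_swap_id\<close>)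

lemma evenperm_star_cycle: "i \<ge> 2 \<Longrightarrow> evenperm (star_cycle i)"
  by (simp add: star_cycle_def evenperm_comp permutation_swap_id evenperm_swap)

lemma pverts_star: "pverts (star_digraph m) = {x. x permutes {..<m} \<and> evenperm x}"
  by (simp add: star_digraph_def)

lemma parcs_star:
  "(u, v) \<in> parcs (star_digraph m) \<longleftrightarrow>
     u \<in> pverts (star_digraph m) \<and> (\<exists>i\<in>{2..<m}. v = u \<circ> star_cycle i)"
  by (auto simp: star_digraph_def star_step_eq_comp[simplified] star_step_eq_comp)

lemma star_vertex_inj: "x \<in> pverts (star_digraph m) \<Longrightarrow> inj x"
  by (auto simp: pverts_star intro: permutes_inj)

lemma star_vertex_eq_iff: "x \<in> pverts (star_digraph m) \<Longrightarrow> x a = x b \<longleftrightarrow> a = b"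
  using star_vertex_inj by (auto simp: inj_eq)

lemma star_vertex_permutation: "x \<in> pverts (star_digraph m) \<Longrightarrow> permutation x"
  by (auto simp: pverts_star intro: permutes_imp_permutation)

lemma star_vertex_comp_cycle:
  assumes "x \<in> pverts (star_digraph m)" "2 \<le> i" "i < m"
  shows "x \<circ> star_cycle i \<in> pverts (star_digraph m)"
proof -
  have "permutation (star_cycle i)"
    by (rule permutes_imp_permutation[OF _ star_cycle_permutes[OF assms(2,3)]]) simp
  then show ?thesis
    using assms star_vertex_permutation[OF assms(1)] evenperm_star_cycle[of i]
    by (auto simp: pverts_star evenperm_comp intro: permutes_compose star_cycle_permutes)
qed

lemma star_vertex_mono: "x \<in> pverts (star_digraph m) \<Longrightarrow> x \<in> pverts (star_digraph (Suc m))"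
  by (auto simp: pverts_star intro: permutes_subset)

lemma star_vertex_last: "x \<in> pverts (star_digraph m) \<Longrightarrow> x m = m"
  by (auto simp: pverts_star permutes_not_in)

text \<open>Together with \<open>star_vertex_mono\<close> and \<open>star_vertex_last\<close>, this
  identifies the smaller digraph's vertices with the fibre \<open>x m = m\<close> of the larger
  one.\<close>

lemma star_vertex_Suc_fixed:
  assumes "x \<in> pverts (star_digraph (Suc m))" "x m = m"
  shows "x \<in> pverts (star_digraph m)"
  using assms permutes_superset[of x "{..<Suc m}" "{..<m}"] by (auto simp: pverts_star less_Suc_eq)

lemma finite_star_vertices: "finite (pverts (star_digraph m))"
  unfolding pverts_star by (rule finite_subset[OF _ finite_permutations[of "{..<m}"]]) auto

lemma id_star_vertex: "id \<in> pverts (star_digraph m)"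
  by (simp add: pverts_star permutes_id)

text \<open>Below three symbols there are no 3-cycles, so the inductive and counting arguments need
  this degenerate case separately.\<close>

lemma star_vertices_le_2:
  assumes "m \<le> 2"
  shows "pverts (star_digraph m) = {id}"
proof -
  have "x = id" if x: "x permutes {..<m}" "evenperm x" for x
  proof -
    have "x = id \<or> x = transpose 0 1"
    proof (cases "m = 2")
      case True
      have "x permutes {0, 1}"
        using x True by (simp add: lessThan_Suc numeral_2_eq_2 insert_commute)
      then show ?thesis
        by (simp add: permutes_doubleton_iff)
    next
      case False
      then have "{..<m} \<subseteq> {0}" using assms by auto
      then have "x permutes {0}" using x permutes_subset by blast
      then show ?thesis by simp
    qed
    then show ?thesis using x by (auto simp: evenperm_swap)
  qed
  then show ?thesis using id_star_vertex by (auto simp: pverts_star)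
qed

section \<open>In-neighbours and orientation\<close>

lemma comp_cycle_cube:
  assumes "i \<ge> 2"
  shows "x \<circ> star_cycle i \<circ> star_cycle i \<circ> star_cycle i = x"
  using star_cycle_cube[OF assms] by (simp add: comp_assoc)

text \<open>The inverse of a 3-cycle is its square. Writing it as two compositions lets
  \<open>star_cycle_apply\<close> evaluate in-neighbours too.\<close>

lemma parcs_star_converse:
  "(u, v) \<in> parcs (star_digraph m) \<longleftrightarrow>
     v \<in> pverts (star_digraph m) \<and> (\<exists>i\<in>{2..<m}. u = v \<circ> star_cycle i \<circ> star_cycle i)"
  (is "?L \<longleftrightarrow> ?R")
proof
  assume ?L
  then show ?R
    by (auto simp: parcs_star intro!: star_vertex_comp_cycle) (metis atLeastLessThan_iff comp_cycle_cube)
next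
  assume ?R
  then show ?L
    by (auto simp: parcs_star intro!: star_vertex_comp_cycle) (metis atLeastLessThan_iff comp_cycle_cube)
qed

lemma star_arc_vertices:
  assumes "(u, v) \<in> parcs (star_digraph m)"
  shows "u \<in> pverts (star_digraph m)" "v \<in> pverts (star_digraph m)"
  using assms parcs_star parcs_star_converse by blast+

text \<open>Follow position 1: going back along c_j gives \<open>u 1 = v 0\<close>, and the arc by
  c_i gives \<open>v 0 = u i\<close>, against injectivity of \<open>u\<close>.\<close>

lemma star_arc_asym:
  assumes "(u, v) \<in> parcs (star_digraph m)"
  shows "(v, u) \<notin> parcs (star_digraph m)"
proof
  assume "(v, u) \<in> parcs (star_digraph m)"
  with assms obtain i j where ij: "i \<ge> 2" "j \<ge> 2" and
    v: "v = u \<circ> star_cycle i" and u: "u = v \<circ> star_cycle j"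
    by (auto simp: parcs_star)
  have "u 1 = v (star_cycle j 1)" by (subst u) simp
  then have "u (Suc 0) = u i" using ij by (simp add: v star_cycle_apply)
  moreover have "inj u" using assms star_arc_vertices star_vertex_inj by blast
  ultimately have "Suc 0 = i" by (simp add: inj_eq)
  then show False using ij by simp
qed

lemma star_pair_digraph: "pair_digraph (star_digraph m)"
proof
  show "finite (parcs (star_digraph m))"
    by (rule finite_subset[OF _ finite_cartesian_product[OF finite_star_vertices finite_star_vertices]])
      (auto dest: star_arc_vertices)
  show "fst e \<noteq> snd e" if "e \<in> parcs (star_digraph m)" for e
    using that star_arc_asym by (metis prod.collapse)
qed (auto simp: finite_star_vertices dest: star_arc_vertices)

lemma star_oriented_simple_graph: "oriented_simple_graph (star_digraph m)"
  using star_pair_digraph star_arc_asym by (auto simp: oriented_simple_graph_def)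

section \<open>Strong connectivity\<close>

text \<open>Each arc lies on the directed triangle of its generator, so it can be undone by two more
  steps along c_i.\<close>

lemma star_reachable_sym:
  assumes "x \<rightarrow>\<^sup>*\<^bsub>with_proj (star_digraph m)\<^esub> y"
  shows "y \<rightarrow>\<^sup>*\<^bsub>with_proj (star_digraph m)\<^esub> x"
proof -
  interpret pair_digraph "star_digraph m" by (rule star_pair_digraph)
  let ?G = "with_proj (star_digraph m)"
  have rev_arc: "b \<rightarrow>\<^sup>*\<^bsub>?G\<^esub> a" if arc: "(a, b) \<in> parcs (star_digraph m)" for a b
  proof -
    obtain i where i: "2 \<le> i" "i < m" "b = a \<circ> star_cycle i" and a: "a \<in> pverts (star_digraph m)"
      using arc by (auto simp: parcs_star)
    have "(b, b \<circ> star_cycle i) \<in> parcs (star_digraph m)"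
      "(b \<circ> star_cycle i, b \<circ> star_cycle i \<circ> star_cycle i) \<in> parcs (star_digraph m)"
      using i a by (auto simp: parcs_star intro!: star_vertex_comp_cycle)
    moreover have "b \<circ> star_cycle i \<circ> star_cycle i = a"
      using i by (simp add: comp_cycle_cube)
    ultimately show ?thesis by (metis reachable_adjI reachable_adj_trans)
  qed
  from assms show ?thesis
  proof (induct rule: reachable_induct)
    case base
    then show ?case by auto
  next
    case (step x y)
    then show ?case using rev_arc reachable_trans by metis
  qed
qed

lemma star_reachable_from_id:
  "x \<in> pverts (star_digraph m) \<Longrightarrow> id \<rightarrow>\<^sup>*\<^bsub>with_proj (star_digraph m)\<^esub> x"
proof (induct m arbitrary: x)
  case 0
  interpret pair_digraph "star_digraph 0" by (rule star_pair_digraph)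
  have "x = id" using 0 star_vertices_le_2[of 0] by auto
  then show ?case using 0 reachable_refl by metis
next
  case (Suc m)
  interpret pair_digraph "star_digraph (Suc m)" by (rule star_pair_digraph)
  let ?G = "with_proj (star_digraph (Suc m))"
  show ?case
  proof (cases "m \<ge> 2")
    case False
    then have "x = id" using Suc.prems star_vertices_le_2[of "Suc m"] by auto
    then show ?thesis using Suc.prems reachable_refl by metis
  next
    case True
    \<comment> \<open>The cases are settled backwards: symbol \<open>m\<close> in its final position
      (induction hypothesis), then in position 1, 0, and any other. Each case is one arc away from
      the preceding one.\<close>
    have fixed: "id \<rightarrow>\<^sup>*\<^bsub>?G\<^esub> y" if y: "y \<in> pverts (star_digraph (Suc m))" "y m = m" for y
    proof -
      have "id \<rightarrow>\<^sup>*\<^bsub>with_proj (star_digraph m)\<^esub> y"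
        by (rule Suc.hyps[OF star_vertex_Suc_fixed[OF y]])
      moreover have "parcs (star_digraph m) \<subseteq> parcs (star_digraph (Suc m))"
        "pverts (star_digraph m) \<subseteq> pverts (star_digraph (Suc m))"
        by (force simp: parcs_star star_vertex_mono)+
      ultimately show ?thesis
        unfolding reachable_def with_proj_simps by (metis rtrancl_on_mono)
    qed
    have one: "id \<rightarrow>\<^sup>*\<^bsub>?G\<^esub> y" if y: "y \<in> pverts (star_digraph (Suc m))" "y 1 = m" for y
    proof -
      have "id \<rightarrow>\<^sup>*\<^bsub>?G\<^esub> (y \<circ> star_cycle m)"
        using y True by (intro fixed) (auto simp: star_cycle_apply intro!: star_vertex_comp_cycle)
      moreover have "(y, y \<circ> star_cycle m) \<in> parcs (star_digraph (Suc m))"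
        using y True by (auto simp: parcs_star)
      \<comment> \<open>The arc leaves \<open>y\<close>, while the path from \<open>id\<close> ends
        at its head; symmetry of reachability turns the arc around.\<close>
      ultimately show ?thesis
        by (metis reachable_adjI reachable_trans star_reachable_sym)
    qed
    have zero: "id \<rightarrow>\<^sup>*\<^bsub>?G\<^esub> y" if y: "y \<in> pverts (star_digraph (Suc m))" "y 0 = m" for y
    proof -
      have "id \<rightarrow>\<^sup>*\<^bsub>?G\<^esub> (y \<circ> star_cycle m)"
        using y True by (intro one) (auto simp: star_cycle_apply intro!: star_vertex_comp_cycle)
      moreover have "(y, y \<circ> star_cycle m) \<in> parcs (star_digraph (Suc m))"
        using y True by (auto simp: parcs_star)
      ultimately show ?thesis
        by (metis reachable_adjI reachable_trans star_reachable_sym)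
    qed
    have "m \<in> x ` {..<Suc m}"
      using Suc.prems permutes_image[of x "{..<Suc m}"] by (simp add: pverts_star)
    then obtain j where j: "j < Suc m" "x j = m" by auto
    consider "j = m" | "j = 0" | "j = 1" | "2 \<le> j" "j < m" using j by linarith
    then show ?thesis
    proof cases
      case 4
      have "id \<rightarrow>\<^sup>*\<^bsub>?G\<^esub> (x \<circ> star_cycle j)"
        using Suc.prems 4 j
        by (intro zero) (auto simp: star_cycle_apply intro!: star_vertex_comp_cycle)
      moreover have "(x, x \<circ> star_cycle j) \<in> parcs (star_digraph (Suc m))"
        using Suc.prems 4 j by (auto simp: parcs_star)
      ultimately show ?thesis
        by (metis reachable_adjI reachable_trans star_reachable_sym)
    qed (metis Suc.prems j(2) fixed one zero)+
  qed
qed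

lemma star_strongly_connected: "strongly_connected (with_proj (star_digraph m))"
proof -
  interpret pair_digraph "star_digraph m" by (rule star_pair_digraph)
  show ?thesis
    unfolding strongly_connected_def with_proj_simps
    using star_reachable_from_id star_reachable_sym reachable_trans id_star_vertex by blast
qed

section \<open>Efficient domination\<close>

definition star_dominators :: "nat \<Rightarrow> (nat \<Rightarrow> nat) set" where
  "star_dominators m = {x \<in> pverts (star_digraph m). x 0 = 0 \<or> x 1 = 0}"

text \<open>Both c_i and its inverse bring into positions 0 and 1 the entry \<open>v i\<close> and
  one of \<open>v 0\<close>, \<open>v 1\<close>. The latter two are nonzero outside the set, so only
  the index with \<open>v i = 0\<close> reaches it.\<close>

lemma star_dominators_perfect: "perfect_pm_dominating (star_digraph m) (star_dominators m)"
  unfolding perfect_pm_dominating_def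
proof
  let ?S = "star_dominators m"
  let ?A = "parcs (star_digraph m)"
  fix v assume "v \<in> pverts (star_digraph m) - ?S"
  then have v: "v \<in> pverts (star_digraph m)" "v 0 \<noteq> 0" "v 1 \<noteq> 0"
    by (auto simp: star_dominators_def)
  obtain j where vj: "v j = 0"
    using v(1) permutes_surj[of v "{..<m}"] by (metis (lifting) mem_Collect_eq pverts_star surjD)
  \<comment> \<open>Beyond the tuple \<open>v\<close> is the identity, so \<open>j\<close> would be
    0, contradicting \<open>v 0 \<noteq> 0\<close>.\<close>
  have "j < m"
  proof (rule ccontr)
    assume "\<not> j < m"
    then have "v j = j" using v(1) by (auto simp: pverts_star permutes_not_in)
    then show False using vj v by auto
  qed
  moreover have "j \<noteq> 0" "j \<noteq> 1" using vj v by metis+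
  ultimately have j: "2 \<le> j" "j < m" by auto
  have jeq: "v k = 0 \<longleftrightarrow> k = j" for k
    using v(1) vj star_vertex_eq_iff by metis
  have "\<exists>!u. u \<in> ?S \<and> (u, v) \<in> ?A"
  proof (rule ex1I[of _ "v \<circ> star_cycle j \<circ> star_cycle j"])
    show "v \<circ> star_cycle j \<circ> star_cycle j \<in> ?S \<and> (v \<circ> star_cycle j \<circ> star_cycle j, v) \<in> ?A"
      using v j vj by (auto simp: star_dominators_def parcs_star_converse star_cycle_apply
          intro!: star_vertex_comp_cycle)
  next
    fix u assume u: "u \<in> ?S \<and> (u, v) \<in> ?A"
    then obtain i where i: "2 \<le> i" "i < m" "u = v \<circ> star_cycle i \<circ> star_cycle i"
      by (auto simp: parcs_star_converse)
    have "u 0 = 0 \<or> u 1 = 0" using u by (auto simp: star_dominators_def)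
    then have "i = j" using i j by (auto simp: star_cycle_apply jeq)
    then show "u = v \<circ> star_cycle j \<circ> star_cycle j" using i by simp
  qed
  moreover have "\<exists>!w. w \<in> ?S \<and> (v, w) \<in> ?A"
  proof (rule ex1I[of _ "v \<circ> star_cycle j"])
    show "v \<circ> star_cycle j \<in> ?S \<and> (v, v \<circ> star_cycle j) \<in> ?A"
      using v j vj by (auto simp: star_dominators_def parcs_star star_cycle_apply
          intro!: star_vertex_comp_cycle)
  next
    fix w assume w: "w \<in> ?S \<and> (v, w) \<in> ?A"
    then obtain i where i: "2 \<le> i" "i < m" "w = v \<circ> star_cycle i"
      by (auto simp: parcs_star)
    have "w 0 = 0 \<or> w 1 = 0" using w by (auto simp: star_dominators_def)
    then have "i = j" using i j by (auto simp: star_cycle_apply jeq)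
    then show "w = v \<circ> star_cycle j" using i by simp
  qed
  ultimately show "(\<exists>!u. u \<in> ?S \<and> (u, v) \<in> ?A) \<and> (\<exists>!w. w \<in> ?S \<and> (v, w) \<in> ?A)" ..
qed

text \<open>The arc gives \<open>v 0 = u i\<close> and \<open>v 1 = u 0\<close>. If
  \<open>u 0\<close> were nonzero, both \<open>u 1\<close> and \<open>u i\<close> would be 0. Hence
  a vertex with arcs inside the set in both directions would have 0 in two positions.\<close>

lemma star_arc_between_dominators:
  assumes "u \<in> star_dominators m" "v \<in> star_dominators m" "(u, v) \<in> parcs (star_digraph m)"
  shows "u 0 = 0" "v 1 = 0"
proof -
  obtain i where i: "2 \<le> i" "v = u \<circ> star_cycle i" and u: "u \<in> pverts (star_digraph m)"
    using assms by (auto simp: parcs_star)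
  have "u 0 = 0 \<or> u 1 = 0" "u i = 0 \<or> u 0 = 0"
    using assms i by (auto simp: star_dominators_def star_cycle_apply)
  moreover have "u i \<noteq> u 1" using u i star_vertex_eq_iff by auto
  ultimately show "u 0 = 0" by auto
  then show "v 1 = 0" using i by (simp add: star_cycle_apply)
qed

lemma star_dominators_stable: "pm_stable (star_digraph m) (star_dominators m)"
  unfolding pm_stable_def
proof
  let ?S = "star_dominators m"
  let ?H = "with_proj (star_digraph m) \<restriction> ?S"
  fix v assume v: "v \<in> ?S"
  have "v 0 \<noteq> v 1" using v star_vertex_eq_iff by (fastforce simp: star_dominators_def)
  have "in_arcs ?H v = {} \<or> out_arcs ?H v = {}"
  proof (rule ccontr)
    assume "\<not> ?thesis"
    then obtain a b where "a \<in> ?S" "(a, v) \<in> parcs (star_digraph m)"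
      and "b \<in> ?S" "(v, b) \<in> parcs (star_digraph m)"
      by (auto simp: in_arcs_def out_arcs_def)
    then have "v 1 = 0" "v 0 = 0"
      using star_arc_between_dominators[of a m v] star_arc_between_dominators[of v m b] v by blast+
    then show False using \<open>v 0 \<noteq> v 1\<close> by simp
  qed
  then show "in_degree ?H v = 0 \<or> out_degree ?H v = 0"
    by (auto simp: in_degree_def out_degree_def)
qed

lemma star_dominators_Epm_set: "Epm_set (star_digraph m) (star_dominators m)"
  using star_dominators_perfect star_dominators_stable
  by (auto simp: Epm_set_def worst_case_efficient_dominating_def star_dominators_def)

section \<open>Density\<close>

lemma star_out_degree:
  assumes "v \<in> pverts (star_digraph m)"
  shows "out_degree (with_proj (star_digraph m)) v = m - 2"
proof -
  have "out_arcs (with_proj (star_digraph m)) v = (\<lambda>i. (v, v \<circ> star_cycle i)) ` {2..<m}"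
    using assms by (auto simp: out_arcs_def parcs_star image_iff) (metis atLeastLessThan_iff)
  moreover have "inj_on (\<lambda>i. (v, v \<circ> star_cycle i)) {2..<m}"
  proof (rule inj_onI)
    fix i j assume ij: "i \<in> {2..<m}" "j \<in> {2..<m}"
      and "(v, v \<circ> star_cycle i) = (v, v \<circ> star_cycle j)"
    \<comment> \<open>Position 0 of the out-neighbour carries \<open>v i\<close>, which determines
      \<open>i\<close>; for in-neighbours position 1 does this.\<close>
    then have "(v \<circ> star_cycle i) 0 = (v \<circ> star_cycle j) 0" by (simp only: prod.inject)
    then show "i = j" using ij assms by (simp add: star_cycle_apply star_vertex_eq_iff)
  qed
  ultimately show ?thesis by (simp add: out_degree_def card_image)
qed

lemma star_in_degree:
  assumes "v \<in> pverts (star_digraph m)"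
  shows "in_degree (with_proj (star_digraph m)) v = m - 2"
proof -
  let ?f = "\<lambda>i. (v \<circ> star_cycle i \<circ> star_cycle i, v)"
  have "in_arcs (with_proj (star_digraph m)) v = ?f ` {2..<m}"
    using assms by (auto simp: in_arcs_def parcs_star_converse image_iff) (metis atLeastLessThan_iff)
  moreover have "inj_on ?f {2..<m}"
  proof (rule inj_onI)
    fix i j assume ij: "i \<in> {2..<m}" "j \<in> {2..<m}" and "?f i = ?f j"
    then have "(v \<circ> star_cycle i \<circ> star_cycle i) 1 = (v \<circ> star_cycle j \<circ> star_cycle j) 1" by (simp only: prod.inject)
    then show "i = j" using ij assms by (simp add: star_cycle_apply star_vertex_eq_iff)
  qed
  ultimately show ?thesis by (simp add: in_degree_def card_image)
qed

text \<open>The position of symbol 0 splits the vertices into \<open>m\<close> classes of equal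
  size, and the dominating set consists of two of them.\<close>

lemma star_density:
  assumes "m \<ge> 2"
  shows "m * card (star_dominators m) = 2 * card (pverts (star_digraph m))"
proof (cases "m = 2")
  case True
  have "star_dominators m = {id}"
    using True by (auto simp: star_dominators_def star_vertices_le_2)
  then show ?thesis using True by (simp add: star_vertices_le_2)
next
  case False
  let ?V = "pverts (star_digraph m)"
  define A where "A j = {x \<in> ?V. x j = 0}" for j
  have fin: "finite (A j)" for j using finite_star_vertices by (simp add: A_def)
  have disj: "A i \<inter> A j = {}" if "i \<noteq> j" for i j
    using that star_vertex_eq_iff by (fastforce simp: A_def)
  \<comment> \<open>Going once around the 3-cycle gives |A i| \<le> |A 0| \<le> |A 1| \<le> |A i|,
    so one inequality yields all equalities.\<close>
  have mono: "card (A (star_cycle i k)) \<le> card (A k)" if i: "2 \<le> i" "i < m" for i k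
  proof (rule card_inj_on_le[of "\<lambda>x. x \<circ> star_cycle i"])
    show "inj_on (\<lambda>x. x \<circ> star_cycle i) (A (star_cycle i k))"
      by (rule inj_onI) (metis comp_cycle_cube i(1))
    show "(\<lambda>x. x \<circ> star_cycle i) ` A (star_cycle i k) \<subseteq> A k"
      using i by (auto simp: A_def intro!: star_vertex_comp_cycle)
  qed (rule fin)
  have eq: "card (A i) = card (A 0)" "card (A 1) = card (A 0)" if "2 \<le> i" "i < m" for i
    using mono[OF that, of 0] mono[OF that, of 1] mono[OF that, of i] that
    by (simp_all add: star_cycle_apply)
  have eq0: "card (A j) = card (A 0)" if "j < m" for j
    using that eq[of j] eq(2)[of 2] False assms by (cases "j = 0 \<or> j = 1") auto
  have "?V = (\<Union>j<m. A j)"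
  proof
    show "?V \<subseteq> (\<Union>j<m. A j)"
    proof
      fix x assume x: "x \<in> ?V"
      then have "x ` {..<m} = {..<m}" by (simp add: pverts_star permutes_image)
      moreover have "0 \<in> {..<m}" using assms by simp
      ultimately have "0 \<in> x ` {..<m}" by simp
      then show "x \<in> (\<Union>j<m. A j)" using x by (auto simp: A_def)
    qed
  qed (auto simp: A_def)
  then have "card ?V = (\<Sum>j<m. card (A j))"
    using card_UN_disjoint[of "{..<m}" A] fin disj by simp
  also have "\<dots> = (\<Sum>j<m. card (A 0))" using eq0 by (intro sum.cong) blast+
  finally have V: "card ?V = m * card (A 0)" by simp
  have "star_dominators m = A 0 \<union> A 1" by (auto simp: star_dominators_def A_def)
  then have "card (star_dominators m) = card (A 0) + card (A 1)"
    using fin disj by (simp add: card_Un_disjoint)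
  then show ?thesis using V eq0[of 1] assms by simp
qed

lemma star_chain_dense: "dense star_chain (\<lambda>n. star_dominators (n + 1))"
  unfolding dense_def star_chain_def
proof (intro allI impI conjI ballI)
  fix n :: nat assume n: "1 \<le> n"
  have "card (pverts (star_digraph (n + 1))) > 0"
    using finite_star_vertices id_star_vertex card_gt_0_iff by blast
  moreover have "real ((n + 1) * card (star_dominators (n + 1))) =
      real (2 * card (pverts (star_digraph (n + 1))))"
    using star_density[of "n + 1"] n by simp
  ultimately show "real (card (star_dominators (n + 1))) / real (card (pverts (star_digraph (n + 1))))
      = 2 / (real n + 1)"
    by (simp add: field_simps)
qed (simp add: star_in_degree star_out_degree)

section \<open>Embeddings\<close>

lemma star_embed_vertex: "x \<in> pverts (star_chain n) \<Longrightarrow> star_embed n x = x"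
  using star_vertex_last[of x "n + 1"] by (simp add: star_embed_def star_chain_def fun_upd_idem)

text \<open>The copy is induced because the only new generator, c_m, puts \<open>u 1\<close> in the
  last position, and \<open>u 1\<close> differs from \<open>m\<close>.\<close>

lemma star_inclusion_arcs:
  assumes "u \<in> pverts (star_digraph m)" "v \<in> pverts (star_digraph m)" "m \<ge> 2"
  shows "(u, v) \<in> parcs (star_digraph (Suc m)) \<longleftrightarrow> (u, v) \<in> parcs (star_digraph m)"
proof
  assume "(u, v) \<in> parcs (star_digraph (Suc m))"
  then obtain i where i: "2 \<le> i" "i < Suc m" "v = u \<circ> star_cycle i"
    by (auto simp: parcs_star)
  have "i \<noteq> m"
  proof
    assume "i = m"
    then have "v m = u 1" using i by (simp add: star_cycle_apply)
    then have "u m = u 1" using star_vertex_last[OF assms(1)] star_vertex_last[OF assms(2)] by simp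
    then show False using assms star_vertex_eq_iff by auto
  qed
  then show "(u, v) \<in> parcs (star_digraph m)" using i assms by (auto simp: parcs_star)
qed (use assms in \<open>auto simp: parcs_star star_vertex_mono\<close>)

text \<open>Reduces inducedness to an equivalence between arcs, which for star digraphs is an
  identity between permutations. The (-) version below differs only in the direction of the image
  arcs.\<close>

lemma star_inclusive_plus_mapI:
  assumes maps: "\<And>x. x \<in> pverts D \<Longrightarrow> \<zeta> x \<in> pverts (star_digraph m)"
    and inj: "inj_on \<zeta> (pverts D)"
    and wf: "pair_wf_digraph D"
    and arcs: "\<And>u v. u \<in> pverts D \<Longrightarrow> v \<in> pverts D \<Longrightarrow>
      (\<zeta> u, \<zeta> v) \<in> parcs (star_digraph m) \<longleftrightarrow> (u, v) \<in> parcs D"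
  shows "inclusive_plus_map D (star_digraph m) \<zeta>"
proof -
  interpret D: pair_wf_digraph D by fact
  let ?H = "plus_image \<zeta> D"
  have verts: "pverts ?H = \<zeta> ` pverts D" by (simp add: plus_image_def)
  have induced: "parcs ?H = {e \<in> parcs (star_digraph m). fst e \<in> pverts ?H \<and> snd e \<in> pverts ?H}"
  proof (intro equalityI subsetI)
    fix e assume "e \<in> parcs ?H"
    then obtain u v where "e = (\<zeta> u, \<zeta> v)" "(u, v) \<in> parcs D"
      by (auto simp: plus_image_def)
    then show "e \<in> {e \<in> parcs (star_digraph m). fst e \<in> pverts ?H \<and> snd e \<in> pverts ?H}"
      using arcs[of u v] D.in_arcsD1[of u v] D.in_arcsD2[of u v] by (simp add: verts)
  next
    fix e assume "e \<in> {e \<in> parcs (star_digraph m). fst e \<in> pverts ?H \<and> snd e \<in> pverts ?H}"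
    then obtain u v where "u \<in> pverts D" "v \<in> pverts D" "e = (\<zeta> u, \<zeta> v)" "e \<in> parcs (star_digraph m)"
      unfolding verts by (cases e) auto
    then show "e \<in> parcs ?H" using arcs[of u v] by (auto simp: plus_image_def)
  qed
  have "pair_wf_digraph (star_digraph m)"
    using star_pair_digraph by (rule pair_digraph.pair_wf_digraph)
  moreover have "pair_wf_digraph ?H"
    by unfold_locales (simp_all add: induced)
  moreover have "pverts ?H \<subseteq> pverts (star_digraph m)" using maps by (auto simp: verts)
  moreover have "parcs ?H \<subseteq> parcs (star_digraph m)" by (subst induced) blast
  ultimately show ?thesis
    using inj induced
    by (simp add: inclusive_plus_map_def induced_subgraph_def subgraph_def compatible_def
        wf_digraph_wp_iff)
qed

lemma star_inclusive_minus_mapI: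
  assumes maps: "\<And>x. x \<in> pverts D \<Longrightarrow> \<zeta> x \<in> pverts (star_digraph m)"
    and inj: "inj_on \<zeta> (pverts D)"
    and wf: "pair_wf_digraph D"
    and arcs: "\<And>u v. u \<in> pverts D \<Longrightarrow> v \<in> pverts D \<Longrightarrow>
      (\<zeta> v, \<zeta> u) \<in> parcs (star_digraph m) \<longleftrightarrow> (u, v) \<in> parcs D"
  shows "inclusive_minus_map D (star_digraph m) \<zeta>"
proof -
  interpret D: pair_wf_digraph D by fact
  let ?H = "minus_image \<zeta> D"
  have verts: "pverts ?H = \<zeta> ` pverts D" by (simp add: minus_image_def)
  have induced: "parcs ?H = {e \<in> parcs (star_digraph m). fst e \<in> pverts ?H \<and> snd e \<in> pverts ?H}"
  proof (intro equalityI subsetI)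
    fix e assume "e \<in> parcs ?H"
    then obtain u v where "e = (\<zeta> v, \<zeta> u)" "(u, v) \<in> parcs D"
      by (auto simp: minus_image_def)
    then show "e \<in> {e \<in> parcs (star_digraph m). fst e \<in> pverts ?H \<and> snd e \<in> pverts ?H}"
      using arcs[of u v] D.in_arcsD1[of u v] D.in_arcsD2[of u v] by (simp add: verts)
  next
    fix e assume "e \<in> {e \<in> parcs (star_digraph m). fst e \<in> pverts ?H \<and> snd e \<in> pverts ?H}"
    then obtain u v where "u \<in> pverts D" "v \<in> pverts D" "e = (\<zeta> v, \<zeta> u)" "e \<in> parcs (star_digraph m)"
      unfolding verts by (cases e) auto
    then show "e \<in> parcs ?H" using arcs[of u v] by (auto simp: minus_image_def)
  qed
  have "pair_wf_digraph (star_digraph m)"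
    using star_pair_digraph by (rule pair_digraph.pair_wf_digraph)
  moreover have "pair_wf_digraph ?H"
    by unfold_locales (simp_all add: induced)
  moreover have "pverts ?H \<subseteq> pverts (star_digraph m)" using maps by (auto simp: verts)
  moreover have "parcs ?H \<subseteq> parcs (star_digraph m)" by (subst induced) blast
  ultimately show ?thesis
    using inj induced
    by (simp add: inclusive_minus_map_def induced_subgraph_def subgraph_def compatible_def
        wf_digraph_wp_iff)
qed

text \<open>Any map agreeing with the identity on vertices is allowed, so that this covers both
  \<open>star_embed\<close> and the segment with last symbol \<open>m\<close>.\<close>

lemma star_inclusion:
  assumes "m \<ge> 2" and \<zeta>: "\<And>x. x \<in> pverts (star_digraph m) \<Longrightarrow> \<zeta> x = x"
  shows "inclusive_map (star_digraph m) (star_digraph (Suc m)) \<zeta>"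
  unfolding inclusive_map_def
proof (rule disjI1, rule star_inclusive_plus_mapI)
  show "pair_wf_digraph (star_digraph m)"
    using star_pair_digraph pair_digraph.pair_wf_digraph by blast
qed (use assms in \<open>auto simp: star_vertex_mono star_inclusion_arcs inj_on_def\<close>)

text \<open>
  The transposition \<open>(k m)\<close> alone would spoil the parity; \<open>(0 1)\<close> repairs it, at the price of
  reversing all arcs.
\<close>

definition star_twist :: "nat \<Rightarrow> nat \<Rightarrow> (nat \<Rightarrow> nat) \<Rightarrow> nat \<Rightarrow> nat" where
  "star_twist m k x = transpose k m \<circ> x \<circ> transpose 0 1"

lemma star_twist_twist: "star_twist m k (star_twist m k x) = x"
  by (simp add: star_twist_def fun_eq_iff)

lemma star_twist_vertex:
  assumes "m \<ge> 2" "k < m" "x \<in> pverts (star_digraph (Suc m))"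
  shows "star_twist m k x \<in> pverts (star_digraph (Suc m))"
proof -
  have "transpose k m permutes {..<Suc m}" "transpose 0 1 permutes {..<Suc m}"
    using assms by (auto intro!: permutes_swap_id)
  moreover have "permutation (transpose k m \<circ> x)"
    using star_vertex_permutation[OF assms(3)] permutation_swap_id by (rule permutation_compose[rotated])
  ultimately show ?thesis
    using assms star_vertex_permutation[OF assms(3)]
    by (auto simp: star_twist_def pverts_star evenperm_comp evenperm_swap permutation_swap_id
        intro!: permutes_compose)
qed

text \<open>From v = u c follows (k m) v s c = (k m) u (c s c) = (k m) u s, so c leads from the
  twist of \<open>v\<close> to that of \<open>u\<close>.\<close>

lemma star_twist_arc:
  assumes "m \<ge> 2" "k < m" "(u, v) \<in> parcs (star_digraph (Suc m))"
  shows "(star_twist m k v, star_twist m k u) \<in> parcs (star_digraph (Suc m))"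
proof -
  obtain i where i: "2 \<le> i" "i < Suc m" "v = u \<circ> star_cycle i"
    using assms by (auto simp: parcs_star)
  have "star_twist m k v \<circ> star_cycle i =
      transpose k m \<circ> u \<circ> (star_cycle i \<circ> transpose 0 1 \<circ> star_cycle i)"
    by (simp add: star_twist_def i comp_assoc)
  also have "\<dots> = star_twist m k u"
    by (simp only: star_cycle_swap star_twist_def)
  finally have "star_twist m k u = star_twist m k v \<circ> star_cycle i" ..
  moreover have "star_twist m k v \<in> pverts (star_digraph (Suc m))"
    using star_twist_vertex[OF assms(1,2) star_arc_vertices(2)[OF assms(3)]] .
  ultimately show ?thesis
    using i by (auto simp: parcs_star)
qed

lemma star_twist_inclusive:
  assumes "m \<ge> 2" "k < m"
  shows "inclusive_map (star_digraph m) (star_digraph (Suc m)) (star_twist m k)"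
  unfolding inclusive_map_def
proof (rule disjI2, rule star_inclusive_minus_mapI)
  show "pair_wf_digraph (star_digraph m)"
    using star_pair_digraph pair_digraph.pair_wf_digraph by blast
  show "inj_on (star_twist m k) (pverts (star_digraph m))"
    by (metis inj_on_inverseI star_twist_twist)
  show "star_twist m k x \<in> pverts (star_digraph (Suc m))" if "x \<in> pverts (star_digraph m)" for x
    using that assms star_twist_vertex star_vertex_mono by blast
  show "(star_twist m k v, star_twist m k u) \<in> parcs (star_digraph (Suc m)) \<longleftrightarrow>
      (u, v) \<in> parcs (star_digraph m)"
    if "u \<in> pverts (star_digraph m)" "v \<in> pverts (star_digraph m)" for u v
    \<comment> \<open>The converse direction is the same arc reversal applied to the twisted pair,
      as the twist is an involution.\<close>
    using star_twist_arc[OF assms] star_inclusion_arcs[OF that assms(1)] star_twist_twist by metis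
qed

section \<open>Splitting the dominating set by its last symbol\<close>

text \<open>The factor (0 1) only exchanges positions 0 and 1, and (k m) fixes symbol 0 since
  \<open>k\<close> and \<open>m\<close> are positive, so domination is preserved while the last
  symbol \<open>m\<close> becomes \<open>k\<close>. The involution gives the reverse
  inclusion.\<close>

lemma star_twist_dominators:
  assumes "m \<ge> 2" "0 < k" "k < m"
  shows "star_twist m k ` star_dominators m = {x \<in> star_dominators (Suc m). x m = k}"
proof
  show "star_twist m k ` star_dominators m \<subseteq> {x \<in> star_dominators (Suc m). x m = k}"
  proof
    fix y assume "y \<in> star_twist m k ` star_dominators m"
    then obtain x where x: "x \<in> star_dominators m" and y: "y = star_twist m k x" by auto
    have xV: "x \<in> pverts (star_digraph m)" using x by (simp add: star_dominators_def)
    have "y \<in> pverts (star_digraph (Suc m))"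
      using xV y assms star_twist_vertex star_vertex_mono by blast
    moreover have "y m = k"
      using assms star_vertex_last[OF xV] by (simp add: y star_twist_def)
    moreover have "y 0 = 0 \<or> y 1 = 0"
      using x assms by (auto simp: y star_twist_def star_dominators_def)
    ultimately show "y \<in> {x \<in> star_dominators (Suc m). x m = k}"
      by (simp add: star_dominators_def)
  qed
  show "{x \<in> star_dominators (Suc m). x m = k} \<subseteq> star_twist m k ` star_dominators m"
  proof
    fix y assume y: "y \<in> {x \<in> star_dominators (Suc m). x m = k}"
    let ?x = "star_twist m k y"
    have "?x \<in> pverts (star_digraph (Suc m))"
      using y assms by (auto simp: star_dominators_def intro: star_twist_vertex)
    moreover have "?x m = m" using y assms by (simp add: star_twist_def)
    ultimately have "?x \<in> pverts (star_digraph m)" by (rule star_vertex_Suc_fixed)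
    moreover have "?x 0 = 0 \<or> ?x 1 = 0"
      using y assms by (auto simp: star_twist_def star_dominators_def)
    ultimately have "?x \<in> star_dominators m" by (simp add: star_dominators_def)
    then show "y \<in> star_twist m k ` star_dominators m" by (metis imageI star_twist_twist)
  qed
qed

lemma star_dominators_Suc_last:
  "star_dominators m = {x \<in> star_dominators (Suc m). x m = m}"
proof -
  have "x \<in> pverts (star_digraph m) \<longleftrightarrow> x \<in> pverts (star_digraph (Suc m)) \<and> x m = m" for x
    using star_vertex_mono star_vertex_last star_vertex_Suc_fixed by blast
  then show ?thesis by (auto simp: star_dominators_def)
qed

lemma star_chain_segmental: "segmental star_chain (\<lambda>n. star_dominators (n + 1))"
  unfolding segmental_def
proof
  show "inclusive_chain star_chain (\<lambda>n. star_dominators (n + 1))"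
    unfolding inclusive_chain_def star_chain_def
  proof (intro allI impI exI[of _ "\<lambda>x. x"] conjI)
    fix n :: nat assume "1 \<le> n"
    then show "inclusive_map (star_digraph (n + 1)) (star_digraph (n + 1 + 1)) (\<lambda>x. x)"
      using star_inclusion[of "n + 1"] by simp
    show "(\<lambda>x. x) ` star_dominators (n + 1) \<subseteq> star_dominators (n + 1 + 1)"
      by (auto simp: star_dominators_def star_vertex_mono)
  qed
next
  show "\<forall>n\<ge>1. \<exists>(I :: nat set) \<zeta>. finite I \<and>
      (\<forall>k\<in>I. inclusive_map (star_chain n) (star_chain (n + 1)) (\<zeta> k)) \<and>
      disjoint_family_on (\<lambda>k. \<zeta> k ` star_dominators (n + 1)) I \<and>
      (\<Union>k\<in>I. \<zeta> k ` star_dominators (n + 1)) = star_dominators (n + 1 + 1)"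
  proof (intro allI impI)
    fix n :: nat assume n: "1 \<le> n"
    define m where "m = n + 1"
    then have m: "m \<ge> 2" using n by simp
    define \<zeta> where "\<zeta> k = (if k = m then \<lambda>x. x else star_twist m k)" for k
    have image: "\<zeta> k ` star_dominators m = {x \<in> star_dominators (Suc m). x m = k}"
      if "k \<in> {1..m}" for k
    proof (cases "k = m")
      case True
      then show ?thesis unfolding \<zeta>_def using star_dominators_Suc_last[of m] by simp
    next
      case False
      then show ?thesis unfolding \<zeta>_def using that star_twist_dominators[OF m, of k] by simp
    qed
    have "\<forall>k\<in>{1..m}. inclusive_map (star_digraph m) (star_digraph (Suc m)) (\<zeta> k)"
      using star_inclusion[OF m, of "\<lambda>x. x"] star_twist_inclusive[OF m] by (simp add: \<zeta>_def)
    moreover have "disjoint_family_on (\<lambda>k. \<zeta> k ` star_dominators m) {1..m}"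
      unfolding disjoint_family_on_def using image by auto
    moreover have "(\<Union>k\<in>{1..m}. \<zeta> k ` star_dominators m) = star_dominators (Suc m)"
    proof -
      \<comment> \<open>Symbol 0 occupies position 0 or 1, hence never the last one, so the fibres
        over 1, ..., m exhaust the set.\<close>
      have "x m \<in> {1..m}" if x: "x \<in> star_dominators (Suc m)" for x
      proof -
        have V: "x \<in> pverts (star_digraph (Suc m))" using x by (simp add: star_dominators_def)
        have "x m \<in> {..<Suc m}" using V permutes_in_image[of x "{..<Suc m}" m] by (simp add: pverts_star)
        moreover have "x m \<noteq> x 0" "x m \<noteq> x 1" using V m by (simp_all add: star_vertex_eq_iff)
        then have "x m \<noteq> 0" using x by (auto simp: star_dominators_def)
        ultimately show ?thesis by auto
      qed
      then show ?thesis using image by auto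
    qed
    ultimately show "\<exists>(I :: nat set) \<zeta>. finite I \<and>
      (\<forall>k\<in>I. inclusive_map (star_chain n) (star_chain (n + 1)) (\<zeta> k)) \<and>
      disjoint_family_on (\<lambda>k. \<zeta> k ` star_dominators (n + 1)) I \<and>
      (\<Union>k\<in>I. \<zeta> k ` star_dominators (n + 1)) = star_dominators (n + 1 + 1)"
      by (intro exI[of _ "{1..m}"] exI[of _ \<zeta>]) (simp add: m_def star_chain_def)
  qed
qed

section \<open>Neighborliness\<close>

text \<open>The three powers of c_i give a directed 3-cycle; asymmetry excludes loops and reversed
  arcs, so nothing else is induced.\<close>

lemma star_cycle_triangle:
  assumes "v \<in> pverts (star_digraph m)" "2 \<le> i" "i < m"
  defines "a \<equiv> v \<circ> star_cycle i" and "b \<equiv> v \<circ> star_cycle i \<circ> star_cycle i"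
  shows "induces_directed_triangle (star_digraph m) {v, a, b}"
proof -
  have V: "a \<in> pverts (star_digraph m)" "b \<in> pverts (star_digraph m)"
    using assms by (auto intro!: star_vertex_comp_cycle)
  have arcs: "(v, a) \<in> parcs (star_digraph m)" "(a, b) \<in> parcs (star_digraph m)"
    "(b, v) \<in> parcs (star_digraph m)"
    using assms V by (auto simp: parcs_star a_def b_def comp_cycle_cube intro!: bexI[of _ i])
  have "(x, x) \<notin> parcs (star_digraph m)" for x
    using star_arc_asym by blast
  note nonarcs = this[of v] this[of a] this[of b] arcs[THEN star_arc_asym]
  have "distinct [v, a, b]"
    using arcs nonarcs by auto
  moreover have "arcs (with_proj (star_digraph m) \<restriction> {v, a, b}) = {(v, a), (a, b), (b, v)}"
    using arcs nonarcs by auto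
  ultimately show ?thesis
    unfolding induces_directed_triangle_def by blast
qed

text \<open>Only c_m leaves the copy, and it carries the last symbol \<open>m\<close> to position 0.
  Its inverse carries it to position 1, which handles in-neighbours.\<close>

lemma star_copy_out_nbhd:
  assumes "m \<ge> 2" "y \<in> out_nbhd (star_digraph (Suc m)) (pverts (star_digraph m))"
  shows "y 0 = m"
proof -
  obtain x i where x: "x \<in> pverts (star_digraph m)" and i: "2 \<le> i" "i < Suc m"
    and y: "y = x \<circ> star_cycle i" "y \<notin> pverts (star_digraph m)"
    using assms by (auto simp: out_nbhd_def parcs_star)
  have "i = m"
    using x i y star_vertex_comp_cycle[of x m i] by (cases "i = m") auto
  then show ?thesis using assms i y star_vertex_last[OF x] by (simp add: star_cycle_apply)
qed

lemma star_copy_in_nbhd: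
  assumes "m \<ge> 2" "y \<in> in_nbhd (star_digraph (Suc m)) (pverts (star_digraph m))"
  shows "y 1 = m"
proof -
  obtain x i where x: "x \<in> pverts (star_digraph m)" and i: "2 \<le> i" "i < Suc m"
    and y: "y = x \<circ> star_cycle i \<circ> star_cycle i" "y \<notin> pverts (star_digraph m)"
    using assms by (auto simp: in_nbhd_def parcs_star_converse)
  have "i = m"
    using x i y star_vertex_comp_cycle[of _ m i] by (cases "i = m") auto
  then show ?thesis using assms i y star_vertex_last[OF x] by (simp add: star_cycle_apply)
qed

text \<open>The position of symbol \<open>m\<close>, 0 or 1, separates the two neighbourhoods. Each
  is stable because an arc moves the entry in position 0 to 1, and the one in position 1 to some
  \<open>i \<ge> 2\<close>.\<close>

lemma star_copy_cuneiform:
  assumes m: "m \<ge> 2"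
  shows "cuneiform (star_digraph (Suc m)) (pverts (star_digraph m))"
proof -
  let ?D = "star_digraph (Suc m)" and ?S = "pverts (star_digraph m)"
  let ?c = "star_cycle m"
  define \<rho> where "\<rho> v = (v \<circ> ?c, v \<circ> ?c \<circ> ?c)" for v :: "nat \<Rightarrow> nat"
  note out = star_copy_out_nbhd[OF m] and inn = star_copy_in_nbhd[OF m]
  have V: "x \<in> pverts ?D" if "x \<in> out_nbhd ?D ?S \<union> in_nbhd ?D ?S" for x
    using that by (auto simp: out_nbhd_def in_nbhd_def dest: star_arc_vertices)
  have "out_nbhd ?D ?S \<inter> in_nbhd ?D ?S = {}"
  proof (rule ccontr)
    assume "\<not> ?thesis"
    then obtain y where "y \<in> out_nbhd ?D ?S" "y \<in> in_nbhd ?D ?S" by blast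
    then show False using out inn star_vertex_eq_iff[OF V, of y 0 1] by auto
  qed
  moreover have "stable ?D (out_nbhd ?D ?S)"
    unfolding stable_def
  proof (intro ballI notI)
    fix u v assume uv: "u \<in> out_nbhd ?D ?S" "v \<in> out_nbhd ?D ?S" "(u, v) \<in> parcs ?D"
    then have "v 1 = m" using out by (auto simp: parcs_star star_cycle_apply)
    then show False using out[OF uv(2)] star_vertex_eq_iff[OF V, of v 0 1] uv by auto
  qed
  moreover have "stable ?D (in_nbhd ?D ?S)"
    unfolding stable_def
  proof (intro ballI notI)
    fix u v assume uv: "u \<in> in_nbhd ?D ?S" "v \<in> in_nbhd ?D ?S" "(u, v) \<in> parcs ?D"
    then obtain i where i: "2 \<le> i" "v = u \<circ> star_cycle i" by (auto simp: parcs_star)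
    then have "v i = m" using inn[OF uv(1)] by (simp add: star_cycle_apply)
    then show False using inn[OF uv(2)] star_vertex_eq_iff[OF V, of v i 1] uv i by auto
  qed
  moreover have "\<rho> ` ?S \<subseteq> parcs ?D \<inter> out_nbhd ?D ?S \<times> in_nbhd ?D ?S"
  proof
    fix e assume "e \<in> \<rho> ` ?S"
    then obtain v where v: "v \<in> ?S" and e: "e = (v \<circ> ?c, v \<circ> ?c \<circ> ?c)" by (auto simp: \<rho>_def)
    have vD: "v \<in> pverts ?D" using v by (rule star_vertex_mono)
    \<comment> \<open>These are the last entries of v c and v c c, so both tuples lie outside the
      copy.\<close>
    have ne: "v (Suc 0) \<noteq> m" "v 0 \<noteq> m"
      using star_vertex_last[OF v] star_vertex_eq_iff[OF v, of 1 m] star_vertex_eq_iff[OF v, of 0 m] m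
      by auto
    have "v \<circ> ?c \<notin> ?S" "v \<circ> ?c \<circ> ?c \<notin> ?S"
      using star_vertex_last[of "v \<circ> ?c" m] star_vertex_last[of "v \<circ> ?c \<circ> ?c" m] ne m
      by (auto simp: star_cycle_apply)
    moreover have "(v, v \<circ> ?c) \<in> parcs ?D" "(v \<circ> ?c, v \<circ> ?c \<circ> ?c) \<in> parcs ?D"
      using vD m by (auto simp: parcs_star intro!: star_vertex_comp_cycle)
    moreover have "(v \<circ> ?c \<circ> ?c, v) \<in> parcs ?D"
      using vD m by (auto simp: parcs_star_converse)
    ultimately show "e \<in> parcs ?D \<inter> out_nbhd ?D ?S \<times> in_nbhd ?D ?S"
      using v by (auto simp: e out_nbhd_def in_nbhd_def)
  qed
  moreover have inj_c: "v = w" if "v \<circ> ?c = w \<circ> ?c" for v w :: "nat \<Rightarrow> nat"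
    using that comp_cycle_cube[OF m] by metis
  then have "bij_betw \<rho> ?S (\<rho> ` ?S)"
    by (auto simp: bij_betw_def inj_on_def \<rho>_def)
  moreover have "\<forall>e\<in>\<rho> ` ?S. \<forall>f\<in>\<rho> ` ?S. e \<noteq> f \<longrightarrow> {fst e, snd e} \<inter> {fst f, snd f} = {}"
  proof (intro ballI impI)
    fix e f assume e: "e \<in> \<rho> ` ?S" and f: "f \<in> \<rho> ` ?S" and "e \<noteq> f"
    then have "fst e \<noteq> fst f" "snd e \<noteq> snd f"
      using inj_c by (auto simp: \<rho>_def)
    \<comment> \<open>A tail is an out-neighbour and a head an in-neighbour of the copy, and these
      sets are disjoint.\<close>
    moreover have "fst e \<noteq> snd f" "snd e \<noteq> fst f"
      using e f \<open>\<rho> ` ?S \<subseteq> _\<close> \<open>out_nbhd ?D ?S \<inter> in_nbhd ?D ?S = {}\<close> by fastforce+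
    ultimately show "{fst e, snd e} \<inter> {fst f, snd f} = {}" by auto
  qed
  moreover have "\<forall>v\<in>?S. induces_directed_triangle ?D {v, fst (\<rho> v), snd (\<rho> v)}"
    using star_cycle_triangle[OF star_vertex_mono, of _ m m] m by (simp add: \<rho>_def)
  ultimately show ?thesis
    unfolding cuneiform_def by blast
qed

lemma star_chain_neighborly: "neighborly star_chain star_embed"
  unfolding neighborly_def
proof (intro allI impI)
  fix n :: nat assume "1 \<le> n"
  then show "cuneiform (star_chain (n + 1)) (star_embed n ` pverts (star_chain n))"
    using star_copy_cuneiform[of "n + 1"] star_embed_vertex by (simp add: star_chain_def)
qed

lemma star_chain_Epm_chain: "Epm_chain star_chain star_embed (\<lambda>n. star_dominators (n + 1))"
  unfolding Epm_chain_def
proof (intro allI impI conjI)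
  fix n :: nat assume "1 \<le> n"
  then show "inclusive_map (star_chain n) (star_chain (n + 1)) (star_embed n)"
    using star_inclusion[of "n + 1" "star_embed n"] star_embed_vertex by (simp add: star_chain_def)
qed (auto simp: star_chain_def intro: star_oriented_simple_graph star_dominators_Epm_set[of "Suc _"])

theorem theorem6:
  shows "(\<forall>n\<ge>1. strongly_connected (with_proj (star_digraph n))) \<and>
    (\<exists>S. Epm_chain star_chain star_embed S \<and>
         neighborly star_chain star_embed \<and>
         segmental star_chain S \<and>
         dense star_chain S)"
  \<comment> \<open>One witness, \<open>\<lambda>n. star_dominators (n + 1)\<close>, serves all
    conditions; the shift matches D_n being the star digraph on n + 1 symbols.\<close>
  using star_strongly_connected star_chain_Epm_chain star_chain_neighborly star_chain_segmental
    star_chain_dense by blast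

end
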